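(* Let $n\ge1$, let $S\subseteq V(G_n)$ be nonempty, and let $r\ge 0$ be an integer. For every vertex $\lambda\in V(G_n)$, there exists a path from $\lambda$ to the closed neighborhood $N_S^{(\le r)}=\{\mu\in V(G_n): d_S(\mu)\le r\}$ (i.e. starting at $\lambda$ and ending at a vertex of $N_S^{(\le r)}$) which is $S$-monotone inward and has length $\max\{d_S(\lambda)-r,0\}$. In particular, if $d_S(\lambda)\ge r$, then there exists an $S$-monotone inward geodesic from $\lambda$ to $N_S^{(\le r)}$ of length $d_S(\lambda)-r$.
   Context: Partition graph: for $n\ge 1$, the vertices of the simple graph $G_n$ are the partitions $\lambda=(\lambda_1\ge\dots\ge\lambda_k>0)$ of $n$. An elementary unit transfer on $\lambda=(\lambda_1,\dots,\lambda_k)$: choose distinct indices $i,j\in\{1,\dots,k\}$, replace $\lambda_i$ by $\lambda_i+1$ and $\lambda_j$ by $\lambda_j-1$, delete the latter if it becomes $0$, and reorder the parts into nonincreasing form; if the resulting partition $\mu$ satisfies $\mu\neq\lambda$, then $\mu$ is obtained from $\lambda$ by an elementary unit transfer. Two partitions $\lambda,\mu$ of $n$ are adjacent in $G_n$ if one of them is obtained from the other by a single elementary unit transfer. The graph $G_n$ is connected. For nonempty $S\subseteq V(G_n)$, $d_S(\lambda)=\min_{\sigma\in S}d_{G_n}(\lambda,\sigma)$, where $d_{G_n}$ is the graph distance. A path $(\lambda_0,\dots,\lambda_m)$ in $G_n$ (consecutive vertices adjacent; length $m\ge 0$, the one-vertex path having length $0$) is $S$-monotone inward if $d_S(\lambda_{i+1})=d_S(\lambda_i)-1$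 for all $0\le i<m$. A geodesic from $\lambda$ to a nonempty set $Y\subseteq V(G_n)$ is a path from $\lambda$ to a vertex of $Y$ of minimum possible length, i.e. of length $d_Y(\lambda)$. *)

theory Defs
  imports "Graph_Theory.Graph_Theory"
begin

section \<open>Distances and geodesics in a graph\<close>

text \<open>
  Paths are the vertex walks of \<^theory>\<open>Graph_Theory.Vertex_Walk\<close>: nonempty lists of vertices
  in which consecutive entries are adjacent, the length being the number of steps.  Vertices are
  not required to be distinct.
\<close>

definition walk_from_to :: "('a, 'b) pre_digraph \<Rightarrow> 'a \<Rightarrow> 'a set \<Rightarrow> 'a list \<Rightarrow> bool" where
  "walk_from_to G u Y p \<longleftrightarrow> vwalk p G \<and> hd p = u \<and> last p \<in> Y"

text \<open>The value is meaningful only if \<open>v\<close> is reachable from \<open>u\<close>.\<close>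

definition graph_dist :: "('a, 'b) pre_digraph \<Rightarrow> 'a \<Rightarrow> 'a \<Rightarrow> nat" where
  "graph_dist G u v = (LEAST m. \<exists>p. walk_from_to G u {v} p \<and> vwalk_length p = m)"

text \<open>The value is meaningful only if \<open>S\<close> is finite and nonempty.\<close>

definition dist_to_set :: "('a, 'b) pre_digraph \<Rightarrow> 'a set \<Rightarrow> 'a \<Rightarrow> nat" where
  "dist_to_set G S u = Min ((\<lambda>s. graph_dist G u s) ` S)"

definition closed_nbhd :: "('a, 'b) pre_digraph \<Rightarrow> 'a set \<Rightarrow> nat \<Rightarrow> 'a set" where
  "closed_nbhd G S r = {v \<in> verts G. dist_to_set G S v \<le> r}"

text \<open>The integers avoid the truncated subtraction of natural numbers.\<close>

definition monotone_inward :: "('a, 'b) pre_digraph \<Rightarrow> 'a set \<Rightarrow> 'a list \<Rightarrow> bool" where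
  "monotone_inward G S p \<longleftrightarrow> vwalk p G \<and>
     (\<forall>i < vwalk_length p. int (dist_to_set G S (p ! (i + 1))) = int (dist_to_set G S (p ! i)) - 1)"

definition geodesic_to :: "('a, 'b) pre_digraph \<Rightarrow> 'a \<Rightarrow> 'a set \<Rightarrow> 'a list \<Rightarrow> bool" where
  "geodesic_to G u Y p \<longleftrightarrow> walk_from_to G u Y p \<and>
     (\<forall>q. walk_from_to G u Y q \<longrightarrow> vwalk_length p \<le> vwalk_length q)"

lemma graph_dist_le: "walk_from_to G u {v} p \<Longrightarrow> graph_dist G u v \<le> vwalk_length p"
  unfolding graph_dist_def by (rule Least_le) blast

lemma graph_dist_attained:
  assumes "u \<rightarrow>\<^sup>*\<^bsub>G\<^esub> v" and "wf_digraph G"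
  obtains p where "walk_from_to G u {v} p" and "vwalk_length p = graph_dist G u v"
proof -
  interpret wf_digraph G by fact
  obtain p where "vwalk p G" "hd p = u" "last p = v"
    using assms(1) reachable_vwalk_conv by blast
  then have "\<exists>m p. walk_from_to G u {v} p \<and> vwalk_length p = m"
    by (auto simp: walk_from_to_def)
  from LeastI_ex[OF this] show thesis
    unfolding graph_dist_def[symmetric] using that by blast
qed

text \<open>The two descriptions of a geodesic agree.\<close>

lemma geodesic_to_iff:
  assumes "wf_digraph G" and "finite Y" and "Y \<noteq> {}" and reach: "\<And>y. y \<in> Y \<Longrightarrow> u \<rightarrow>\<^sup>*\<^bsub>G\<^esub> y"
  shows "geodesic_to G u Y p \<longleftrightarrow> walk_from_to G u Y p \<and> vwalk_length p = dist_to_set G Y u"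
proof -
  have lb: "dist_to_set G Y u \<le> vwalk_length q" if "walk_from_to G u Y q" for q
  proof -
    have "dist_to_set G Y u \<le> graph_dist G u (last q)"
      unfolding dist_to_set_def using that assms(2) by (intro Min_le) (auto simp: walk_from_to_def)
    also have "\<dots> \<le> vwalk_length q"
      using that by (intro graph_dist_le) (auto simp: walk_from_to_def)
    finally show ?thesis .
  qed
  have "dist_to_set G Y u \<in> (\<lambda>s. graph_dist G u s) ` Y"
    unfolding dist_to_set_def using assms by (intro Min_in) auto
  then obtain y where y: "y \<in> Y" "dist_to_set G Y u = graph_dist G u y" by blast
  obtain q where "walk_from_to G u {y} q" "vwalk_length q = graph_dist G u y"
    using graph_dist_attained[OF reach[OF y(1)] assms(1)] by blast
  with y have "walk_from_to G u Y q" "vwalk_length q = dist_to_set G Y u"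
    by (auto simp: walk_from_to_def)
  then show ?thesis
    unfolding geodesic_to_def using lb by (metis le_antisym)
qed

section \<open>The partition graph\<close>

definition partitions_of :: "nat \<Rightarrow> nat list set" where
  "partitions_of n = {xs. sorted_wrt (\<ge>) xs \<and> (\<forall>x\<in>set xs. 0 < x) \<and> sum_list xs = n}"

text \<open>
  Move one unit from part \<open>j\<close> to part \<open>i\<close>, delete a part that became zero, and restore the
  nonincreasing order.  Indices start at zero.
\<close>

definition transfer :: "nat list \<Rightarrow> nat \<Rightarrow> nat \<Rightarrow> nat list" where
  "transfer xs i j = rev (sort (filter (\<lambda>x. 0 < x) (xs[i := xs ! i + 1, j := xs ! j - 1])))"

definition unit_transfer :: "nat list \<Rightarrow> nat list \<Rightarrow> bool" where
  "unit_transfer xs ys \<longleftrightarrow>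
     (\<exists>i < length xs. \<exists>j < length xs. i \<noteq> j \<and> ys = transfer xs i j \<and> ys \<noteq> xs)"

text \<open>A simple graph is represented by its symmetric irreflexive set of arcs.\<close>

definition partition_graph :: "nat \<Rightarrow> nat list pair_pre_digraph" where
  "partition_graph n =
     \<lparr> pverts = partitions_of n,
       parcs = {(xs, ys) \<in> partitions_of n \<times> partitions_of n.
                  unit_transfer xs ys \<or> unit_transfer ys xs} \<rparr>"

lemma finite_partitions_of: "finite (partitions_of n)"
proof (rule finite_subset)
  have len: "length xs \<le> sum_list xs" if "\<forall>x\<in>set xs. 0 < x" for xs :: "nat list"
    using that by (induction xs) auto
  show "partitions_of n \<subseteq> {xs. set xs \<subseteq> {..n} \<and> length xs \<le> n}"
    using len member_le_sum_list by (fastforce simp: partitions_of_def)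
  show "finite {xs. set xs \<subseteq> {..n} \<and> length xs \<le> n}"
    by (rule finite_lists_length_le) simp
qed

lemma pair_graph_partition_graph: "pair_graph (partition_graph n)"
proof
  show "finite (parcs (partition_graph n))"
    by (rule finite_subset[of _ "partitions_of n \<times> partitions_of n"])
      (auto simp: partition_graph_def finite_partitions_of)
qed (auto simp: partition_graph_def finite_partitions_of unit_transfer_def symmetric_def sym_def)

lemma transfer_in_partitions_of:
  assumes "xs \<in> partitions_of n" "i < length xs" "j < length xs" "i \<noteq> j"
  shows "transfer xs i j \<in> partitions_of n"
proof -
  let ?ys = "xs[i := xs ! i + 1, j := xs ! j - 1]"
  have "0 < xs ! j" using assms by (auto simp: partitions_of_def)
  moreover have "xs ! j \<le> sum_list (xs[i := xs ! i + 1])"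
    using assms by (metis elem_le_sum_list length_list_update nth_list_update_neq)
  moreover have "xs ! i \<le> sum_list xs" using assms by (simp add: elem_le_sum_list)
  ultimately have "sum_list ?ys = sum_list xs"
    using assms by (simp add: sum_list_update)
  moreover have "sum_list (filter (\<lambda>x. 0 < x) zs) = sum_list zs" for zs :: "nat list"
    by (induction zs) auto
  moreover have "sum_list (rev (sort zs)) = sum_list zs" for zs :: "nat list"
    by (metis mset_rev mset_sort sum_mset_sum_list)
  ultimately have "sum_list (transfer xs i j) = n"
    using assms by (simp add: transfer_def partitions_of_def)
  then show ?thesis
    by (auto simp: transfer_def partitions_of_def sorted_wrt_rev)
qed

lemma reachable_one_part:
  assumes "1 \<le> n" "xs \<in> partitions_of n"
  shows "xs \<rightarrow>\<^sup>*\<^bsub>with_proj (partition_graph n)\<^esub> [n]"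
  using assms(2)
proof (induction "n - hd xs" arbitrary: xs rule: less_induct)
  case less
  interpret pair_graph "partition_graph n" by (rule pair_graph_partition_graph)
  have ne: "xs \<noteq> []" using less.prems assms(1) by (auto simp: partitions_of_def)
  show ?case
  proof (cases "length xs = 1")
    case True
    then have "xs = [n]" using less.prems by (auto simp: partitions_of_def length_Suc_conv)
    moreover have "pverts (partition_graph n) = partitions_of n" by (simp add: partition_graph_def)
    ultimately show ?thesis using less.prems by (auto intro!: reachable_refl)
  next
    case False
    with ne have l: "0 < length xs" "1 < length xs" by (cases xs; auto)+
    let ?ys = "transfer xs 0 1"
    have ys: "?ys \<in> partitions_of n" by (rule transfer_in_partitions_of) (use less.prems l in auto)
    have mem: "hd xs + 1 \<in> set ?ys"
    proof -
      have "xs[0 := xs ! 0 + 1, 1 := xs ! 1 - 1] ! 0 = hd xs + 1"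
        using l by (simp add: hd_conv_nth)
      then have "hd xs + 1 \<in> set (xs[0 := xs ! 0 + 1, 1 := xs ! 1 - 1])"
        using l by (metis length_list_update nth_mem)
      then show ?thesis by (simp add: transfer_def)
    qed
    then have gt: "hd xs + 1 \<le> hd ?ys"
      using ys by (cases ?ys) (auto simp: partitions_of_def)
    have "?ys \<noteq> []" using mem by auto
    then have "hd ?ys \<le> n"
      using ys member_le_sum_list[of "hd ?ys" ?ys] by (auto simp: partitions_of_def)
    with gt have "n - hd ?ys < n - hd xs" by linarith
    then have "?ys \<rightarrow>\<^sup>*\<^bsub>with_proj (partition_graph n)\<^esub> [n]" using less.hyps ys by blast
    moreover have "unit_transfer xs ?ys"
      unfolding unit_transfer_def using l gt by (intro exI[of _ 0] exI[of _ 1] conjI) auto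
    then have "(xs, ?ys) \<in> parcs (partition_graph n)"
      using ys less.prems by (simp add: partition_graph_def)
    ultimately show ?thesis using adj_reachable_trans by simp
  qed
qed

text \<open>Hence all the distances occurring in the partition graph are genuine.\<close>

lemma reachable_partition_graph:
  assumes "1 \<le> n" "xs \<in> partitions_of n" "ys \<in> partitions_of n"
  shows "xs \<rightarrow>\<^sup>*\<^bsub>with_proj (partition_graph n)\<^esub> ys"
proof -
  interpret pair_graph "partition_graph n" by (rule pair_graph_partition_graph)
  show ?thesis
    using reachable_one_part[OF assms(1)] assms(2,3) symmetric_reachable reachable_trans sym_arcs
    by metis
qed

end

theory Submission
  imports Defs
begin

text \<open>
  The partition graph is finite and connected, and the argument is one about distances in such
  graphs.  Let \<open>d\<close> be the distance to a finite nonempty set \<open>S\<close> that can be reached from every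
  vertex.

  Putting an arc from \<open>u\<close> to \<open>v\<close> in front of a shortest walk from \<open>v\<close> to \<open>S\<close> shows that one step
  lowers \<open>d\<close> by at most one (\<open>dist_to_set_arc\<close>); so a walk of length \<open>m\<close> lowers \<open>d\<close> by at most \<open>m\<close>
  (\<open>dist_to_set_walk\<close>).  A shortest walk from \<open>u\<close> to \<open>S\<close>
  must therefore lose exactly one unit of distance in every step: its first \<open>i\<close> steps lower \<open>d\<close>
  by at most \<open>i\<close>, and what is left of it is a walk to \<open>S\<close> of length \<open>d u - i\<close>
  (\<open>dist_to_set_shortest_nth\<close>).  Stopping it after \<open>k\<close> steps gives an inward monotone walk to a
  vertex at distance \<open>d u - k\<close> (\<open>ex_monotone_inward_walk\<close>); with \<open>k = d u - r\<close> it ends in the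
  neighbourhood of radius \<open>r\<close>.  It is a geodesic, since a walk from \<open>u\<close> into that neighbourhood
  lowers \<open>d\<close> from \<open>d u\<close> to at most \<open>r\<close> and so has at least \<open>d u - r\<close> steps.
\<close>

text \<open>
  Reachability from every vertex makes \<open>dist_to_set\<close> the length of an actual walk wherever it is
  evaluated, in particular at the intermediate vertices of a walk.
\<close>

locale reachable_target = wf_digraph +
  fixes S
  assumes finite_target: "finite S"
    and target_nonempty: "S \<noteq> {}"
    and target_reachable: "u \<in> verts G \<Longrightarrow> s \<in> S \<Longrightarrow> u \<rightarrow>\<^sup>*\<^bsub>G\<^esub> s"
begin

lemma dist_to_set_le:
  assumes "walk_from_to G u S p"
  shows "dist_to_set G S u \<le> vwalk_length p"
proof -
  have "dist_to_set G S u \<le> graph_dist G u (last p)"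
    unfolding dist_to_set_def using assms finite_target
    by (intro Min_le) (auto simp: walk_from_to_def)
  also have "\<dots> \<le> vwalk_length p"
    using assms by (intro graph_dist_le) (auto simp: walk_from_to_def)
  finally show ?thesis .
qed

lemma dist_to_set_attained:
  assumes "u \<in> verts G"
  obtains p where "walk_from_to G u S p" and "vwalk_length p = dist_to_set G S u"
proof -
  have "dist_to_set G S u \<in> (\<lambda>s. graph_dist G u s) ` S"
    unfolding dist_to_set_def using finite_target target_nonempty by (intro Min_in) auto
  then obtain s where s: "s \<in> S" "dist_to_set G S u = graph_dist G u s"
    by blast
  obtain p where "walk_from_to G u {s} p" "vwalk_length p = graph_dist G u s"
    using graph_dist_attained[OF target_reachable[OF assms s(1)] wf_digraph_axioms] by blast
  with s that show thesis
    by (auto simp: walk_from_to_def)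
qed

lemma dist_to_set_arc:
  assumes "(u, v) \<in> arcs_ends G"
  shows "dist_to_set G S u \<le> Suc (dist_to_set G S v)"
proof -
  have "v \<in> verts G"
    using assms by (rule adj_in_verts)
  then obtain p where p: "walk_from_to G v S p" "vwalk_length p = dist_to_set G S v"
    by (rule dist_to_set_attained)
  then have "walk_from_to G u S (u # p)"
    using assms vwalk_wf_digraph_consI by (auto simp: walk_from_to_def vwalk_def)
  from dist_to_set_le[OF this] p show ?thesis
    by (auto simp: walk_from_to_def vwalk_def neq_Nil_conv)
qed

lemma dist_to_set_walk:
  assumes "vwalk p G"
  shows "dist_to_set G S (hd p) \<le> vwalk_length p + dist_to_set G S (last p)"
  using assms
proof (induction rule: vwalk_induct)
  case (Cons u v p)
  then show ?case
    using dist_to_set_arc[of u v] by simp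
qed simp

text \<open>
  The rest of the walk from its \<open>i\<close>-th vertex bounds the distance there from above, and the initial
  piece up to that vertex bounds it from below; for a shortest walk the two bounds coincide.
\<close>

lemma dist_to_set_shortest_nth:
  assumes p: "walk_from_to G u S p" "vwalk_length p = dist_to_set G S u"
    and "i < length p"
  shows "dist_to_set G S (p ! i) = dist_to_set G S u - i"
proof (rule antisym)
  have walk: "vwalk p G" "hd p = u" "last p \<in> S" "p \<noteq> []"
    using p(1) by (auto simp: walk_from_to_def)
  have "vwalk (drop i p) G"
    using walk \<open>i < length p\<close> by (intro vwalkI_append_r[of "drop i p" "take i p"]) auto
  then have "walk_from_to G (p ! i) S (drop i p)"
    using walk \<open>i < length p\<close> by (simp add: walk_from_to_def hd_drop_conv_nth)
  from dist_to_set_le[OF this] p(2)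
  show "dist_to_set G S (p ! i) \<le> dist_to_set G S u - i"
    by simp
  have "vwalk (take (Suc i) p) G"
    using walk by (intro vwalkI_append_l[of "take (Suc i) p" "drop (Suc i) p"]) auto
  from dist_to_set_walk[OF this]
  show "dist_to_set G S u - i \<le> dist_to_set G S (p ! i)"
    using walk \<open>i < length p\<close>
    by (simp add: take_Suc_conv_app_nth hd_append hd_conv_nth split: if_splits)
qed

lemma ex_monotone_inward_walk:
  assumes "u \<in> verts G" and "k \<le> dist_to_set G S u"
  obtains p where "vwalk p G" "hd p = u" "dist_to_set G S (last p) = dist_to_set G S u - k"
    and "monotone_inward G S p" "vwalk_length p = k"
proof -
  obtain q where q: "walk_from_to G u S q" "vwalk_length q = dist_to_set G S u"
    using assms(1) by (rule dist_to_set_attained)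
  then have walk: "vwalk q G" "hd q = u" "q \<noteq> []"
    by (auto simp: walk_from_to_def)
  with q(2) assms(2) have k: "k < length q"
    by (cases q) auto
  let ?p = "take (Suc k) q"
  have p: "vwalk ?p G"
    using walk by (intro vwalkI_append_l[of ?p "drop (Suc k) q"]) auto
  have dist: "dist_to_set G S (q ! i) = dist_to_set G S u - i" if "i \<le> k" for i
    using that k by (intro dist_to_set_shortest_nth[OF q]) auto
  have "last ?p = q ! k"
    using k by (simp add: take_Suc_conv_app_nth)
  then have "dist_to_set G S (last ?p) = dist_to_set G S u - k"
    by (simp add: dist)
  moreover have "monotone_inward G S ?p"
    using p k assms(2) by (auto simp: monotone_inward_def dist)
  ultimately show thesis
    using that[of ?p] p walk k by simp
qed

end

lemma reachable_target_partition_graph: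
  assumes "n \<ge> 1" and "S \<subseteq> pverts (partition_graph n)" and "S \<noteq> {}"
  shows "reachable_target (partition_graph n) S"
proof -
  interpret pair_graph "partition_graph n"
    by (rule pair_graph_partition_graph)
  have verts: "pverts (partition_graph n) = partitions_of n"
    by (simp add: partition_graph_def)
  show ?thesis
  proof
    show "finite S"
      using assms(2) finite_partitions_of verts by (metis finite_subset)
  qed (use assms verts reachable_partition_graph in auto)
qed

theorem proposition5p8:
  fixes n r :: nat and S :: "nat list set" and lam :: "nat list"
  assumes "n \<ge> 1"
    and "S \<subseteq> pverts (partition_graph n)" and "S \<noteq> {}"
    and "lam \<in> pverts (partition_graph n)"
  shows "(\<exists>p. walk_from_to (partition_graph n) lam (closed_nbhd (partition_graph n) S r) p
             \<and> monotone_inward (partition_graph n) S p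
             \<and> int (vwalk_length p) = max (int (dist_to_set (partition_graph n) S lam) - int r) 0)
       \<and> (dist_to_set (partition_graph n) S lam \<ge> r \<longrightarrow>
           (\<exists>p. geodesic_to (partition_graph n) lam (closed_nbhd (partition_graph n) S r) p
              \<and> monotone_inward (partition_graph n) S p
              \<and> int (vwalk_length p) = int (dist_to_set (partition_graph n) S lam) - int r))"
proof -
  interpret reachable_target "partition_graph n" S
    using assms by (intro reachable_target_partition_graph)
  let ?G = "with_proj (partition_graph n)"
  let ?d = "dist_to_set ?G S"
  \<comment> \<open>Truncated subtraction is meant here: if already \<open>?d lam \<le> r\<close>, the walk stays at \<open>lam\<close>.\<close>
  obtain p where p: "vwalk p ?G" "hd p = lam" "?d (last p) = ?d lam - (?d lam - r)"
      "monotone_inward ?G S p" "vwalk_length p = ?d lam - r"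
    using assms(4) by (auto intro: ex_monotone_inward_walk[of lam "?d lam - r"])
  have "last p \<in> verts ?G"
    using p(1) by (auto simp: vwalk_def)
  then have walk: "walk_from_to ?G lam (closed_nbhd ?G S r) p"
    using p by (auto simp: walk_from_to_def closed_nbhd_def)
  have "?d lam - r \<le> vwalk_length q" if "walk_from_to ?G lam (closed_nbhd ?G S r) q" for q
    using that dist_to_set_walk[of q] by (auto simp: walk_from_to_def closed_nbhd_def)
  then have "geodesic_to ?G lam (closed_nbhd ?G S r) p"
    using walk p(5) by (simp add: geodesic_to_def)
  moreover have "int (vwalk_length p) = max (int (?d lam) - int r) 0"
    unfolding p(5) by linarith
  ultimately show ?thesis
    using walk p(4) by (intro conjI impI exI[of _ p]) auto
qed

end
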